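(* Let $T$ be an infinite rooted tree, let $0<p<\infty$, let $\psi:T\to\mathbb{C}$, and let $M_\psi:\mathbb{T}_\infty\to\mathbb{T}_p$ be a bounded multiplication operator. Then $M_\psi$ is a compact operator if and only if $M_p(n,\psi)\to0$ as $n\to\infty$, i.e., $\psi\in\mathbb{T}_{p,0}$.
   Context: Let $T$ be an infinite rooted tree with root $o$; $T$ also denotes its vertex set. For a vertex $v$, $|v|$ is the number of edges in the unique path from $o$ to $v$. For $n\in\mathbb{N}_0=\{0,1,2,\dots\}$, $D_n=\{v\in T:|v|=n\}$, and $c_n$ is the number of elements of $D_n$, assumed finite for each $n$ (so $1\le c_n<\infty$). For $f:T\to\mathbb{C}$ and $0<p<\infty$ put $M_p(n,f)=\left(\frac1{c_n}\sum_{|v|=n}|f(v)|^p\right)^{1/p}$, and $M_\infty(n,f)=\max_{|v|=n}|f(v)|$. For $0<p\le\infty$ put $\|f\|_p=\sup_{n\in\mathbb{N}_0}M_p(n,f)$, $\mathbb{T}_p=\{f:T\to\mathbb{C}:\|f\|_p<\infty\}$ and $\mathbb{T}_{p,0}=\{f\in\mathbb{T}_p:\lim_{n\to\infty}M_p(n,f)=0\}$. For $\psi:T\to\mathbb{C}$, $M_\psi f=\psi f$ (pointwise product). $M_\psi:X\to Y$ is bounded if it maps $X$ into $Y$ and $\sup\{\|\psi f\|_Y/\|f\|_X: f\in X, f\neq0\}<\infty$. It is compact if for every $\|\cdot\|_X$-bounded sequence $\{f_n\}$ in $X$ the sequence $\{\psi f_n\}$ has a subsequence converging in $Y$ with respect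 to $\|\cdot\|_Y$. *)

theory Defs
  imports "HOL-Analysis.Analysis" "Graph_Theory.Digraph_Component"
begin

text \<open>
  Following the convention of the Graph\_Theory entry, an undirected simple graph is a
  symmetric digraph without loops and parallel arcs; unlike the locale \<open>graph\<close> of that entry,
  the graph may be infinite. In such a digraph every edge, traversed back and forth, gives a
  closed walk of length 2 satisfying \<^const>\<open>pre_digraph.cycle\<close>, so the constants
  \<open>forest\<close> and \<open>tree\<close> of that entry do not express what is needed
  here. The cycles of the undirected graph are exactly those of length at least 3.
\<close>

locale rooted_tree = sym_digraph T + loopfree_digraph T + nomulti_digraph T
  for T :: "('v, 'e) pre_digraph" +
  fixes r :: 'v
  assumes root_in_verts: "r \<in> verts T"
    and connected: "Digraph_Component.connected T"
    and acyclic: "\<not> (\<exists>es. pre_digraph.cycle T es \<and> length es \<ge> 3)"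

definition tree_level :: "('v, 'e) pre_digraph \<Rightarrow> 'v \<Rightarrow> 'v \<Rightarrow> nat" where
  "tree_level T r v = length (THE es. pre_digraph.apath T r es v)"

definition tree_sphere :: "('v, 'e) pre_digraph \<Rightarrow> 'v \<Rightarrow> nat \<Rightarrow> 'v set" where
  "tree_sphere T r n = {v \<in> verts T. tree_level T r v = n}"

locale infinite_rooted_tree = rooted_tree T r
  for T :: "('v, 'e) pre_digraph" and r :: 'v +
  assumes infinite_verts: "infinite (verts T)"
    and finite_sphere: "\<And>n. finite (tree_sphere T r n)"

text \<open>
  A function on the tree is a total function on the type of vertices; all notions below depend
  only on its values on \<^term>\<open>verts T\<close>. Exponents \<open>0 < p \<le> \<infinity>\<close> are extended reals.
\<close>

definition tree_mean :: "('v, 'e) pre_digraph \<Rightarrow> 'v \<Rightarrow> ereal \<Rightarrow> nat \<Rightarrow> ('v \<Rightarrow> complex) \<Rightarrow> real" where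
  "tree_mean T r p n f =
    (if p = \<infinity> then Max ((\<lambda>v. cmod (f v)) ` tree_sphere T r n)
     else ((1 / real (card (tree_sphere T r n))) *
            (\<Sum>v\<in>tree_sphere T r n. cmod (f v) powr real_of_ereal p))
          powr (1 / real_of_ereal p))"

definition tree_norm :: "('v, 'e) pre_digraph \<Rightarrow> 'v \<Rightarrow> ereal \<Rightarrow> ('v \<Rightarrow> complex) \<Rightarrow> ereal" where
  "tree_norm T r p f = (SUP n. ereal (tree_mean T r p n f))"

definition tree_space :: "('v, 'e) pre_digraph \<Rightarrow> 'v \<Rightarrow> ereal \<Rightarrow> ('v \<Rightarrow> complex) set" where
  "tree_space T r p = {f. tree_norm T r p f < \<infinity>}"

definition tree_space0 :: "('v, 'e) pre_digraph \<Rightarrow> 'v \<Rightarrow> ereal \<Rightarrow> ('v \<Rightarrow> complex) set" where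
  "tree_space0 T r p = {f \<in> tree_space T r p. (\<lambda>n. tree_mean T r p n f) \<longlonglongrightarrow> 0}"

definition mult_op :: "('v \<Rightarrow> complex) \<Rightarrow> ('v \<Rightarrow> complex) \<Rightarrow> 'v \<Rightarrow> complex" where
  "mult_op \<psi> f = (\<lambda>v. \<psi> v * f v)"

text \<open>
  The source space has exponent \<open>p\<close>, the target space exponent \<open>q\<close>.
\<close>

definition bounded_mult_op ::
  "('v, 'e) pre_digraph \<Rightarrow> 'v \<Rightarrow> ereal \<Rightarrow> ereal \<Rightarrow> ('v \<Rightarrow> complex) \<Rightarrow> bool" where
  "bounded_mult_op T r p q \<psi> \<longleftrightarrow>
    mult_op \<psi> ` tree_space T r p \<subseteq> tree_space T r q \<and>
    (SUP f \<in> {f \<in> tree_space T r p. \<exists>v\<in>verts T. f v \<noteq> 0}.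
       tree_norm T r q (mult_op \<psi> f) / tree_norm T r p f) < \<infinity>"

definition compact_mult_op ::
  "('v, 'e) pre_digraph \<Rightarrow> 'v \<Rightarrow> ereal \<Rightarrow> ereal \<Rightarrow> ('v \<Rightarrow> complex) \<Rightarrow> bool" where
  "compact_mult_op T r p q \<psi> \<longleftrightarrow>
    (\<forall>F :: nat \<Rightarrow> 'v \<Rightarrow> complex.
       (\<forall>n. F n \<in> tree_space T r p) \<and> (\<exists>B::real. \<forall>n. tree_norm T r p (F n) \<le> ereal B) \<longrightarrow>
       (\<exists>s :: nat \<Rightarrow> nat. strict_mono s \<and>
          (\<exists>g \<in> tree_space T r q.
             (\<lambda>k. tree_norm T r q (\<lambda>v. mult_op \<psi> (F (s k)) v - g v)) \<longlonglongrightarrow> 0)))"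

end

theory Submission
  imports Defs "HOL-Complex_Analysis.Great_Picard"
begin

text \<open>
  The operator is compact when the means of \<open>\<psi>\<close> vanish: a bounded sequence has a pointwise
  convergent subsequence by a diagonal argument, the spheres far from the root contribute
  uniformly little, and on each of the remaining finitely many finite spheres pointwise
  convergence is convergence in mean. Conversely, the indicator functions of spheres are bounded,
  and their images tend to 0 pointwise, so a limit point in norm must be 0; hence the means of
  \<open>\<psi>\<close> cannot stay away from 0 along a subsequence. Since the triangle inequality
  fails for \<open>p < 1\<close>, only monotonicity and homogeneity of the means are used.
\<close>

section \<open>Elementary properties of means and norms\<close>

lemma tree_mean_ereal:
  "tree_mean T r (ereal p) n f =
    ((\<Sum>v\<in>tree_sphere T r n. cmod (f v) powr p) / real (card (tree_sphere T r n))) powr (1 / p)"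
  by (simp add: tree_mean_def)

lemma tree_mean_nonneg: "0 \<le> tree_mean T r (ereal p) n f"
  by (simp add: tree_mean_ereal)

lemma tree_norm_nonneg: "0 \<le> tree_norm T r (ereal p) f"
  unfolding tree_norm_def
  by (rule SUP_upper2[where i = 0]) (simp_all add: tree_mean_nonneg)

lemma tree_mean_le_norm:
  assumes "tree_norm T r p f \<le> ereal B"
  shows "tree_mean T r p n f \<le> B"
proof -
  have "ereal (tree_mean T r p n f) \<le> tree_norm T r p f"
    unfolding tree_norm_def by (rule SUP_upper) simp
  with assms have "ereal (tree_mean T r p n f) \<le> ereal B" by (rule order_trans[rotated])
  then show ?thesis by simp
qed

lemma tree_norm_leI:
  assumes "\<And>n. tree_mean T r p n f \<le> B"
  shows "tree_norm T r p f \<le> ereal B"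
  unfolding tree_norm_def using assms by (intro SUP_least) simp

lemma tree_spaceI:
  assumes "\<And>n. tree_mean T r p n f \<le> B"
  shows "f \<in> tree_space T r p"
  using tree_norm_leI[of T r p f B] assms by (auto simp: tree_space_def)

lemma tree_mean_cong:
  assumes "\<And>v. v \<in> tree_sphere T r n \<Longrightarrow> cmod (f v) = cmod (g v)"
  shows "tree_mean T r (ereal p) n f = tree_mean T r (ereal p) n g"
  using assms by (simp add: tree_mean_ereal)

text \<open>Monotonicity and homogeneity in one estimate, valid for every exponent
  \<open>p > 0\<close>: both survive the passage through \<open>powr p\<close>, the average and
  \<open>powr (1 / p)\<close>. Applied to products, \<open>C\<close> is a bound of the factor that
  multiplies \<psi>.\<close>

lemma tree_mean_mono_scaled:
  assumes "0 < p" "0 \<le> C"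
    and le: "\<And>v. v \<in> tree_sphere T r n \<Longrightarrow> cmod (f v) \<le> C * cmod (g v)"
  shows "tree_mean T r (ereal p) n f \<le> C * tree_mean T r (ereal p) n g"
proof -
  let ?S = "tree_sphere T r n"
  have "(\<Sum>v\<in>?S. cmod (f v) powr p) \<le> (\<Sum>v\<in>?S. C powr p * cmod (g v) powr p)"
    using assms by (intro sum_mono) (simp flip: powr_mult add: powr_mono2)
  then have "(\<Sum>v\<in>?S. cmod (f v) powr p) / real (card ?S)
      \<le> C powr p * ((\<Sum>v\<in>?S. cmod (g v) powr p) / real (card ?S))"
    by (simp add: divide_right_mono flip: sum_distrib_left)
  then have "tree_mean T r (ereal p) n f
      \<le> (C powr p * ((\<Sum>v\<in>?S. cmod (g v) powr p) / real (card ?S))) powr (1 / p)"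
    using assms by (auto simp: tree_mean_ereal intro!: powr_mono2 divide_nonneg_nonneg sum_nonneg)
  also have "\<dots> = (C powr p) powr (1 / p) * tree_mean T r (ereal p) n g"
    by (subst powr_mult) (simp_all add: tree_mean_ereal sum_nonneg)
  also have "\<dots> = C * tree_mean T r (ereal p) n g"
    using assms by (simp add: powr_powr)
  finally show ?thesis .
qed

section \<open>Convergence in mean and pointwise convergence\<close>

lemma tree_mean_tendsto_zero:
  assumes "0 < p" and lim: "\<And>v. v \<in> tree_sphere T r n \<Longrightarrow> (\<lambda>k. h k v) \<longlonglongrightarrow> 0"
  shows "(\<lambda>k. tree_mean T r (ereal p) n (h k)) \<longlonglongrightarrow> 0"
  unfolding tree_mean_ereal
proof (rule tendsto_zero_powrI[where b = "1 / p"])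
  have "(\<lambda>k. cmod (h k v) powr p) \<longlonglongrightarrow> 0" if "v \<in> tree_sphere T r n" for v
    using lim[OF that] assms(1)
    by (intro tendsto_zero_powrI[where b = p] tendsto_norm_zero) auto
  then show "(\<lambda>k. (\<Sum>v\<in>tree_sphere T r n. cmod (h k v) powr p)
      / real (card (tree_sphere T r n))) \<longlonglongrightarrow> 0"
    by (intro tendsto_divide_zero tendsto_null_sum) auto
  show "\<forall>\<^sub>F k in sequentially. 0 \<le> (\<Sum>v\<in>tree_sphere T r n. cmod (h k v) powr p)
      / real (card (tree_sphere T r n))"
    by (simp add: sum_nonneg)
qed (use assms(1) in auto)

text \<open>A single summand is at most the whole sum, and the factor undoes the normalisation by
  the size of the sphere.\<close>

lemma norm_le_tree_mean:
  assumes "0 < p" "finite (tree_sphere T r n)" "v \<in> tree_sphere T r n"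
  shows "cmod (f v) \<le> real (card (tree_sphere T r n)) powr (1 / p) * tree_mean T r (ereal p) n f"
proof -
  let ?S = "tree_sphere T r n"
  have pos: "0 < card ?S" using assms by (auto simp: card_gt_0_iff)
  have "cmod (f v) powr p \<le> (\<Sum>v\<in>?S. cmod (f v) powr p)"
    using assms by (intro member_le_sum) auto
  then have "(cmod (f v) powr p) powr (1 / p) \<le> (\<Sum>v\<in>?S. cmod (f v) powr p) powr (1 / p)"
    using assms by (intro powr_mono2) auto
  then show ?thesis
    using assms pos by (auto simp: tree_mean_ereal powr_powr powr_divide sum_nonneg)
qed

text \<open>Point evaluation is continuous at 0: the norm dominates the mean over the sphere of
  \<open>v\<close>, which dominates the value at \<open>v\<close> up to a constant independent of
  \<open>k\<close>.\<close>

lemma tendsto_zero_if_tree_norm: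
  assumes "0 < p" "finite (tree_sphere T r n)" "v \<in> tree_sphere T r n"
    and lim: "(\<lambda>k. tree_norm T r (ereal p) (h k)) \<longlonglongrightarrow> 0"
  shows "(\<lambda>k. h k v) \<longlonglongrightarrow> 0"
proof -
  have "(\<lambda>k. ereal (tree_mean T r (ereal p) n (h k))) \<longlonglongrightarrow> ereal 0"
  proof (rule tendsto_sandwich)
    show "\<forall>\<^sub>F k in sequentially. ereal (tree_mean T r (ereal p) n (h k)) \<le> tree_norm T r (ereal p) (h k)"
      unfolding tree_norm_def by (intro always_eventually allI SUP_upper) simp
    show "\<forall>\<^sub>F k in sequentially. ereal 0 \<le> ereal (tree_mean T r (ereal p) n (h k))"
      by (simp add: tree_mean_nonneg)
  qed (use lim in \<open>simp_all add: zero_ereal_def\<close>)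
  then have "(\<lambda>k. tree_mean T r (ereal p) n (h k)) \<longlonglongrightarrow> 0" by simp
  from tendsto_mult_right_zero[OF this]
  have "(\<lambda>k. real (card (tree_sphere T r n)) powr (1 / p) * tree_mean T r (ereal p) n (h k)) \<longlonglongrightarrow> 0" .
  then show ?thesis
    by (rule Lim_null_comparison[rotated]) (simp add: norm_le_tree_mean[OF assms(1-3)])
qed

text \<open>A dominated convergence principle with dominating function
  \<open>C * cmod (\<psi> v)\<close>. It makes the means beyond some \<open>N\<close> small
  uniformly in \<open>k\<close>; the remaining finitely many means are small for large
  \<open>k\<close>.\<close>

lemma tree_norm_tendsto_zero:
  assumes "0 < p" "0 \<le> C"
    and le: "\<And>k v n. v \<in> tree_sphere T r n \<Longrightarrow> cmod (h k v) \<le> C * cmod (\<psi> v)"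
    and lim: "\<And>v n. v \<in> tree_sphere T r n \<Longrightarrow> (\<lambda>k. h k v) \<longlonglongrightarrow> 0"
    and \<psi>: "(\<lambda>n. tree_mean T r (ereal p) n \<psi>) \<longlonglongrightarrow> 0"
  shows "(\<lambda>k. tree_norm T r (ereal p) (h k)) \<longlonglongrightarrow> 0"
proof (rule order_tendstoI)
  show "\<forall>\<^sub>F k in sequentially. a < tree_norm T r (ereal p) (h k)" if "a < 0" for a
    by (intro always_eventually allI order.strict_trans2[OF that] tree_norm_nonneg)
next
  fix a :: ereal assume "0 < a"
  \<comment> \<open>A supremum preserves only weak bounds, so the gap between \<open>e\<close> and
    \<open>a\<close> supplies the final strict inequality.\<close>
  then obtain e where e: "0 < ereal e" "ereal e < a" using ereal_dense2 by blast
  have "(\<lambda>n. C * tree_mean T r (ereal p) n \<psi>) \<longlonglongrightarrow> 0"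
    using tendsto_mult_right_zero[OF \<psi>] .
  then have "\<forall>\<^sub>F n in sequentially. C * tree_mean T r (ereal p) n \<psi> < e"
    using e(1) by (simp add: order_tendstoD)
  then obtain N where N: "\<And>n. n \<ge> N \<Longrightarrow> C * tree_mean T r (ereal p) n \<psi> < e"
    by (auto simp: eventually_sequentially)
  have "\<forall>\<^sub>F k in sequentially. tree_mean T r (ereal p) n (h k) < e" for n
    using e(1) by (intro order_tendstoD(2)[OF tree_mean_tendsto_zero[OF assms(1)]] lim) auto
  then have "\<forall>\<^sub>F k in sequentially. \<forall>n\<in>{..<N}. tree_mean T r (ereal p) n (h k) < e"
    by (intro eventually_ball_finite) auto
  then show "\<forall>\<^sub>F k in sequentially. tree_norm T r (ereal p) (h k) < a"
  proof eventually_elim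
    case (elim k)
    have "tree_mean T r (ereal p) n (h k) \<le> e" for n
    proof (cases "n < N")
      case False
      then have "C * tree_mean T r (ereal p) n \<psi> < e" using N by simp
      moreover have "tree_mean T r (ereal p) n (h k) \<le> C * tree_mean T r (ereal p) n \<psi>"
        by (rule tree_mean_mono_scaled[OF assms(1,2) le])
      ultimately show ?thesis by simp
    qed (use elim in \<open>auto intro: less_imp_le\<close>)
    then have "tree_norm T r (ereal p) (h k) \<le> ereal e" by (rule tree_norm_leI)
    with e(2) show ?case by simp
  qed
qed

section \<open>Sufficiency of vanishing means\<close>

lemma compact_mult_op_if_means_vanish:
  assumes fin: "\<And>n. finite (tree_sphere T r n)" and "0 < p"
    and \<psi>: "(\<lambda>n. tree_mean T r (ereal p) n \<psi>) \<longlonglongrightarrow> 0"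
  shows "compact_mult_op T r \<infinity> (ereal p) \<psi>"
  unfolding compact_mult_op_def
proof (intro allI impI)
  fix F :: "nat \<Rightarrow> 'a \<Rightarrow> complex"
  assume "(\<forall>n. F n \<in> tree_space T r \<infinity>) \<and> (\<exists>B::real. \<forall>n. tree_norm T r \<infinity> (F n) \<le> ereal B)"
  then obtain B0 where B0: "\<And>k. tree_norm T r \<infinity> (F k) \<le> ereal B0" by blast
  \<comment> \<open>The scaling constant must be nonnegative, while the sign of \<open>B0\<close> is
    unknown: spheres may be empty here, and \<open>Max {}\<close> is unspecified.\<close>
  define B where "B = max B0 0"
  let ?V = "\<Union>n. tree_sphere T r n"
  have FB: "cmod (F k v) \<le> B" if "v \<in> ?V" for k v
  proof -
    from that obtain n where n: "v \<in> tree_sphere T r n" by blast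
    then have "cmod (F k v) \<le> tree_mean T r \<infinity> n (F k)"
      using fin by (simp add: tree_mean_def)
    also have "\<dots> \<le> B0" using B0 by (rule tree_mean_le_norm)
    finally show ?thesis by (simp add: B_def)
  qed
  \<comment> \<open>The diagonal argument applies since \<open>?V\<close> is a countable union of
    finite sets and at each of its points the values stay in a fixed disc.\<close>
  have "countable ?V" using fin by (simp add: countable_finite)
  then obtain s where s: "strict_mono (s :: nat \<Rightarrow> nat)"
    and "\<And>v. v \<in> ?V \<Longrightarrow> \<exists>l. (\<lambda>k. F (s k) v) \<longlonglongrightarrow> l"
    by (rule function_convergent_subsequence[of ?V F B]) (use FB in auto)
  then obtain f where f: "\<And>v. v \<in> ?V \<Longrightarrow> (\<lambda>k. F (s k) v) \<longlonglongrightarrow> f v" by metis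
  \<comment> \<open>The bound passes to the limit; it puts the image of \<open>f\<close> into the
    target space and gives the constant \<open>2 * B\<close> for the differences below.\<close>
  have fB: "cmod (f v) \<le> B" if "v \<in> ?V" for v
    using FB[OF that] by (intro Lim_bounded[OF tendsto_norm[OF f[OF that]], of 0]) auto
  obtain K where K: "\<And>n. tree_mean T r (ereal p) n \<psi> \<le> K"
    using Bseq_bdd_above[OF convergent_imp_Bseq[OF convergentI[OF \<psi>]]]
    by (auto simp: bdd_above_def)
  have "mult_op \<psi> f \<in> tree_space T r (ereal p)"
  proof (rule tree_spaceI)
    fix n
    have "tree_mean T r (ereal p) n (mult_op \<psi> f) \<le> B * tree_mean T r (ereal p) n \<psi>"
    proof (rule tree_mean_mono_scaled[OF \<open>0 < p\<close>])
      show "cmod (mult_op \<psi> f v) \<le> B * cmod (\<psi> v)" if "v \<in> tree_sphere T r n" for v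
        using mult_right_mono[OF fB, of v "cmod (\<psi> v)"] that
        by (auto simp: mult_op_def norm_mult mult.commute)
    qed (simp add: B_def)
    also have "\<dots> \<le> B * K" using K by (simp add: B_def mult_left_mono)
    finally show "tree_mean T r (ereal p) n (mult_op \<psi> f) \<le> B * K" .
  qed
  moreover have "(\<lambda>k. tree_norm T r (ereal p) (\<lambda>v. mult_op \<psi> (F (s k)) v - mult_op \<psi> f v)) \<longlonglongrightarrow> 0"
  proof (rule tree_norm_tendsto_zero[where C = "2 * B" and \<psi> = \<psi>, OF \<open>0 < p\<close> _ _ _ \<psi>])
    fix v n assume "v \<in> tree_sphere T r n"
    then have v: "v \<in> ?V" by blast
    show "cmod (mult_op \<psi> (F (s k)) v - mult_op \<psi> f v) \<le> 2 * B * cmod (\<psi> v)" for k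
    proof -
      have "cmod (F (s k) v - f v) \<le> 2 * B"
        using norm_triangle_ineq4[of "F (s k) v" "f v"] FB[OF v, of "s k"] fB[OF v] by linarith
      then show ?thesis
        by (simp add: mult_op_def norm_mult mult.commute mult_left_mono flip: right_diff_distrib)
    qed
    show "(\<lambda>k. mult_op \<psi> (F (s k)) v - mult_op \<psi> f v) \<longlonglongrightarrow> 0"
      using tendsto_mult_left[OF f[OF v], of "\<psi> v"] by (simp add: mult_op_def LIM_zero)
  qed (simp add: B_def)
  ultimately show "\<exists>s :: nat \<Rightarrow> nat. strict_mono s \<and>
      (\<exists>g \<in> tree_space T r (ereal p).
        (\<lambda>k. tree_norm T r (ereal p) (\<lambda>v. mult_op \<psi> (F (s k)) v - g v)) \<longlonglongrightarrow> 0)"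
    using s by blast
qed

section \<open>Necessity of vanishing means\<close>

lemma means_vanish_if_compact_mult_op:
  assumes fin: "\<And>n. finite (tree_sphere T r n)" and "0 < p"
    and compact: "compact_mult_op T r \<infinity> (ereal p) \<psi>"
  shows "(\<lambda>n. tree_mean T r (ereal p) n \<psi>) \<longlonglongrightarrow> 0"
proof (rule ccontr)
  let ?M = "\<lambda>n. tree_mean T r (ereal p) n"
  assume "\<not> ?thesis"
  \<comment> \<open>As means are nonnegative, failure of convergence to 0 means that infinitely many
    of them are at least some \<open>e > 0\<close>; \<open>t\<close> enumerates these
    levels.\<close>
  then obtain e where e: "e > 0" and "\<not> (\<forall>\<^sub>F n in sequentially. ?M n \<psi> < e)"
    using tree_mean_nonneg[of T r p _ \<psi>] by (auto simp: tendsto_iff dist_real_def)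
  then have "\<exists>\<^sub>F n in sequentially. e \<le> ?M n \<psi>"
    by (simp add: frequently_def not_le)
  then have "infinite {n. e \<le> ?M n \<psi>}"
    by (simp add: frequently_cofinite flip: cofinite_eq_sequentially)
  then obtain t :: "nat \<Rightarrow> nat" where t: "strict_mono t" and te: "\<And>k. e \<le> ?M (t k) \<psi>"
    using infinite_enumerate by blast
  define F :: "nat \<Rightarrow> 'a \<Rightarrow> complex"
    where "F k v = of_bool (v \<in> tree_sphere T r (t k))" for k v
  \<comment> \<open>The junk value \<open>Max {}\<close> accounts for possibly empty spheres, so that their nonemptiness need not be proved.\<close>
  have "tree_mean T r \<infinity> n (F k) \<le> max 1 (Max {})" for n k
  proof (cases "tree_sphere T r n = {}")
    case False
    then have "Max ((\<lambda>v. cmod (F k v)) ` tree_sphere T r n) \<le> 1"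
      using fin by (subst Max_le_iff) (auto simp: F_def)
    then show ?thesis by (simp add: tree_mean_def)
  qed (simp add: tree_mean_def)
  then have "F k \<in> tree_space T r \<infinity>" "tree_norm T r \<infinity> (F k) \<le> ereal (max 1 (Max {}))" for k
    by (rule tree_spaceI tree_norm_leI)+
  then obtain s :: "nat \<Rightarrow> nat" and g where s: "strict_mono s"
    and lim: "(\<lambda>k. tree_norm T r (ereal p) (\<lambda>v. mult_op \<psi> (F (s k)) v - g v)) \<longlonglongrightarrow> 0"
    using compact unfolding compact_mult_op_def by blast
  \<comment> \<open>A vertex has only one level, so each \<open>v\<close> lies in the support of at
    most one \<open>F k\<close>. The images thus vanish at \<open>v\<close> eventually, and the norm
    limit \<open>g\<close> agrees with this pointwise limit.\<close>
  have g: "g v = 0" if v: "v \<in> tree_sphere T r n" for v n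
  proof -
    have "(\<lambda>k. mult_op \<psi> (F (s k)) v - g v) \<longlonglongrightarrow> 0"
      using tendsto_zero_if_tree_norm[OF \<open>0 < p\<close> fin v lim] .
    moreover have "\<forall>\<^sub>F k in sequentially. mult_op \<psi> (F (s k)) v - g v = - g v"
      unfolding eventually_sequentially
    proof (intro exI allI impI)
      \<comment> \<open>Strict monotonicity gives \<open>t (s k) \<ge> k > n\<close>, so the support
        has moved past the level of \<open>v\<close>.\<close>
      fix k assume "Suc n \<le> k"
      moreover have "k \<le> t (s k)"
        using strict_mono_imp_increasing[OF strict_mono_o[OF t s], of k] by simp
      ultimately have "v \<notin> tree_sphere T r (t (s k))"
        using v by (auto simp: tree_sphere_def)
      then show "mult_op \<psi> (F (s k)) v - g v = - g v" by (simp add: mult_op_def F_def)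
    qed
    ultimately have "(\<lambda>k :: nat. - g v) \<longlonglongrightarrow> 0" by (simp add: tendsto_cong)
    then show ?thesis by (simp add: LIMSEQ_const_iff)
  qed
  have "\<forall>\<^sub>F k in sequentially. tree_norm T r (ereal p) (\<lambda>v. mult_op \<psi> (F (s k)) v - g v) < ereal e"
    using lim e by (intro order_tendstoD(2)) auto
  then obtain k where "tree_norm T r (ereal p) (\<lambda>v. mult_op \<psi> (F (s k)) v - g v) < ereal e"
    by (auto simp: eventually_sequentially)
  moreover have "ereal (?M (t (s k)) (\<lambda>v. mult_op \<psi> (F (s k)) v - g v))
      \<le> tree_norm T r (ereal p) (\<lambda>v. mult_op \<psi> (F (s k)) v - g v)"
    unfolding tree_norm_def by (rule SUP_upper) simp
  ultimately have "?M (t (s k)) (\<lambda>v. mult_op \<psi> (F (s k)) v - g v) < e"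
    by (metis ereal_less_le less_ereal.simps(1) order.strict_trans1)
  \<comment> \<open>On this sphere the indicator is 1 and \<open>g\<close> is 0, so the difference
    is exactly \<psi>, whose mean there is at least \<open>e\<close>.\<close>
  moreover have "?M (t (s k)) (\<lambda>v. mult_op \<psi> (F (s k)) v - g v) = ?M (t (s k)) \<psi>"
    by (rule tree_mean_cong) (simp add: mult_op_def F_def g)
  ultimately show False using te[of "s k"] by simp
qed

theorem theorem8:
  fixes T :: "('v, 'e) pre_digraph" and r :: 'v and p :: real and \<psi> :: "'v \<Rightarrow> complex"
  assumes "infinite_rooted_tree T r"
    and "0 < p"
    and "bounded_mult_op T r \<infinity> (ereal p) \<psi>"
  shows "(compact_mult_op T r \<infinity> (ereal p) \<psi> \<longleftrightarrow> (\<lambda>n. tree_mean T r (ereal p) n \<psi>) \<longlonglongrightarrow> 0) \<and>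
         ((\<lambda>n. tree_mean T r (ereal p) n \<psi>) \<longlonglongrightarrow> 0 \<longleftrightarrow> \<psi> \<in> tree_space0 T r (ereal p))"
proof -
  note fin = infinite_rooted_tree.finite_sphere[OF assms(1)]
  \<comment> \<open>A convergent sequence of means is bounded, which yields the second
    equivalence.\<close>
  have "\<psi> \<in> tree_space T r (ereal p)" if "(\<lambda>n. tree_mean T r (ereal p) n \<psi>) \<longlonglongrightarrow> 0"
    using tree_spaceI Bseq_bdd_above[OF convergent_imp_Bseq[OF convergentI[OF that]]]
    by (fastforce simp: bdd_above_def)
  then show ?thesis
    using compact_mult_op_if_means_vanish[OF fin assms(2)]
      means_vanish_if_compact_mult_op[OF fin assms(2)]
    by (auto simp: tree_space0_def)
qed

end
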